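(* Let $\varphi_e$ and $\varphi_{e_1}$ be two ruled surfaces in $\mathbb{R}^3$ that form a Bertrand surface offset, with offset angle $\theta$ and offset distance $\theta^*$. Put $$A=\frac{ds}{ds_1}(\gamma\cos\theta-\sin\theta),$$ $$B=A\,\frac{ds}{ds_1}\Big[-(\sin\theta+A\cos\theta)\Delta+(\cos\theta-A\sin\theta)\delta-\big(A(\gamma\cos\theta-\sin\theta)+\cos\theta+\gamma\sin\theta\big)\theta^*\Big],$$ where $A\neq 0$. Then the dual spherical radius of curvature $\bar\rho_1$ of $\varphi_{e_1}$ is given by $$\cos\bar\rho_1=A(1+A^2)^{-1/2}+\varepsilon\,BA^{-1}(1+A^2)^{-3/2}.$$
   Context: Dual numbers are $\bar a=a+\varepsilon a^*$ with $a,a^*\in\mathbb{R}$, $\varepsilon\neq 0$, $\varepsilon^2=0$. For a differentiable real function $f$, $f(x+\varepsilon x^* )=f(x)+\varepsilon x^*f'(x)$; e.g. $\cos(x+\varepsilon x^* )=\cos x-\varepsilon x^*\sin x$, $\sin(x+\varepsilon x^* )=\sin x+\varepsilon x^*\cos x$, $\sqrt{x+\varepsilon x^*}=\sqrt x+\varepsilon\frac{x^*}{2\sqrt x}$ for $x>0$. Dual vectors are $\tilde a=\vec a+\varepsilon\vec a^*$ with $\vec a,\vec a^*\in\mathbb{R}^3$; scalar and vector products are extended $\varepsilon$-bilinearly. A ruled surface $\varphi_e=\vec c(s)+v\,\vec e(s)$ (all data smooth) is parametrized so that $\langle \vec e,\vec e\rangle=1$, $\langle \vec e',\vec e'\rangle=1$,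 $\langle \vec c',\vec e'\rangle=0$, where prime is $d/ds$; so $s$ is the arc length of the real indicatrix $\vec e(s)$ and $\vec c$ is the striction line. It is represented by the dual unit vector $\tilde e=\vec e+\varepsilon\,\vec c\times\vec e$. Put $\vec t=\vec e'$, $\vec g=\vec e\times\vec t$; the conical curvature $\gamma$ is defined by $\vec e'=\vec t$, $\vec t'=\gamma\vec g-\vec e$, $\vec g'=-\gamma\vec t$. Put $\Delta=\det(\vec c',\vec e,\vec t)$, $\delta=\langle\vec c',\vec e\rangle$. The dual Darboux frame is $\{\tilde e,\tilde t,\tilde g\}$ with $\tilde t=\vec t+\varepsilon\,\vec c\times\vec t$, $\tilde g=\vec g+\varepsilon\,\vec c\times\vec g$. The dual conical curvature is $\bar\gamma=\gamma+\varepsilon(\delta-\gamma\Delta)$. The dual spherical radius of curvature $\bar\rho=\rho+\varepsilon\rho^*$ is the dual angle between $\tilde e$ and the unit dual Darboux vector $(\bar\gamma\tilde e+\tilde g)/\sqrt{1+\bar\gamma^2}$; it satisfies $\cos\bar\rho=\bar\gamma/\sqrt{1+\bar\gamma^2}$, $\sin\bar\rho=1/\sqrt{1+\bar\gamma^2}$. The corresponding objects of a second ruled surface $\varphi_{e_1}$ (with its own parameter $s_1$, derivatives taken with respect to $s_1$) carry the subscript $1$. $\varphi_e$ and $\varphi_{e_1}$ form a Bertrand surface offset if, under a correspondence $s_1=s_1(s)$ between their rulings (differentiable with nonvanishing derivative), $\tilde t=\tilde t_1$ at corresponding parameters. The frames are then related by $\tilde e_1=\cos\bar\theta\,\tilde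 e-\sin\bar\theta\,\tilde g$, $\tilde t_1=\tilde t$, $\tilde g_1=\sin\bar\theta\,\tilde e+\cos\bar\theta\,\tilde g$, where $\bar\theta=\theta+\varepsilon\theta^*$ ($0\le\theta\le\pi$, $\theta^*\in\mathbb{R}$) is the dual angle between $\tilde e$ and $\tilde e_1$; $\theta$ is the offset angle and $\theta^*$ the offset distance. $ds/ds_1$ is the derivative of the inverse correspondence $s=s(s_1)$. *)

theory Defs
  imports "HOL-Analysis.Analysis"
begin

section \<open>Dual numbers and dual vectors\<close>

text \<open>
  \<open>Dual a b\<close> stands for \<open>a + \<epsilon> b\<close> with \<open>\<epsilon>\<^sup>2 = 0\<close>. Dual numbers are elements of
  \<open>real dual\<close>, dual vectors are elements of \<open>(real ^ 3) dual\<close>.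
\<close>

datatype 'a dual = Dual (primal: 'a) (tangent: 'a)

instantiation dual :: (ab_group_add) ab_group_add
begin

definition "0 = Dual 0 0"
definition "x + y = Dual (primal x + primal y) (tangent x + tangent y)"
definition "- x = Dual (- primal x) (- tangent x)"
definition "x - y = Dual (primal x - primal y) (tangent x - tangent y)"

instance
  by standard
    (simp_all add: zero_dual_def plus_dual_def uminus_dual_def minus_dual_def algebra_simps)

end

instantiation dual :: (comm_ring_1) comm_ring_1
begin

definition "1 = Dual 1 0"
definition "x * y = Dual (primal x * primal y) (primal x * tangent y + tangent x * primal y)"

instance
  by standard
    (simp_all add: zero_dual_def one_dual_def plus_dual_def times_dual_def algebra_simps)

end

text \<open>The rule \<open>f (x + \<epsilon> x\<^sup>*) = f x + \<epsilon> x\<^sup>* f' x\<close> for differentiable real functions.\<close>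

definition dual_lift :: "(real \<Rightarrow> real) \<Rightarrow> real dual \<Rightarrow> real dual" where
  "dual_lift f x = Dual (f (primal x)) (tangent x * deriv f (primal x))"

abbreviation dual_cos :: "real dual \<Rightarrow> real dual" where "dual_cos \<equiv> dual_lift cos"
abbreviation dual_sin :: "real dual \<Rightarrow> real dual" where "dual_sin \<equiv> dual_lift sin"
abbreviation dual_sqrt :: "real dual \<Rightarrow> real dual" where "dual_sqrt \<equiv> dual_lift sqrt"
abbreviation dual_inverse :: "real dual \<Rightarrow> real dual" where "dual_inverse \<equiv> dual_lift inverse"

definition dual_scale :: "real dual \<Rightarrow> (real ^ 3) dual \<Rightarrow> (real ^ 3) dual" where
  "dual_scale a x =
    Dual (primal a *\<^sub>R primal x) (primal a *\<^sub>R tangent x + tangent a *\<^sub>R primal x)"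

definition dual_inner :: "(real ^ 3) dual \<Rightarrow> (real ^ 3) dual \<Rightarrow> real dual" where
  "dual_inner x y =
    Dual (primal x \<bullet> primal y) (primal x \<bullet> tangent y + tangent x \<bullet> primal y)"

definition is_dual_angle :: "real dual \<Rightarrow> (real ^ 3) dual \<Rightarrow> (real ^ 3) dual \<Rightarrow> bool" where
  "is_dual_angle \<phi> x y \<longleftrightarrow>
    0 \<le> primal \<phi> \<and> primal \<phi> \<le> pi \<and> dual_inner x y = dual_cos \<phi>"

text \<open>
  For unit dual vectors with linearly independent primal parts the dual angle is unique; otherwise
  the dual cosine does not see the tangent part of the angle, and only \<open>is_dual_angle\<close> is meaningful.
\<close>

definition dual_angle :: "(real ^ 3) dual \<Rightarrow> (real ^ 3) dual \<Rightarrow> real dual" where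
  "dual_angle x y = (THE \<phi>. is_dual_angle \<phi> x y)"


section \<open>Ruled surfaces\<close>

definition smooth_curve_on :: "real set \<Rightarrow> (real \<Rightarrow> real ^ 3) \<Rightarrow> bool" where
  "smooth_curve_on I f \<longleftrightarrow>
    (\<exists>D :: nat \<Rightarrow> real \<Rightarrow> real ^ 3. D 0 = f \<and>
      (\<forall>n. \<forall>t\<in>I. (D n has_vector_derivative D (Suc n) t) (at t)))"

text \<open>The data of a ruled surface \<open>(s, v) \<mapsto> striction s + v director s\<close>, with \<open>s\<close> in \<open>params\<close>.\<close>

record ruled_data =
  params :: "real set"
  striction :: "real \<Rightarrow> real ^ 3"
  director :: "real \<Rightarrow> real ^ 3"

abbreviation vderiv :: "(real \<Rightarrow> real ^ 3) \<Rightarrow> real \<Rightarrow> real ^ 3" where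
  "vderiv f s \<equiv> vector_derivative f (at s)"

definition ruled_surface :: "ruled_data \<Rightarrow> bool" where
  "ruled_surface S \<longleftrightarrow>
    open (params S) \<and> is_interval (params S) \<and> params S \<noteq> {} \<and>
    smooth_curve_on (params S) (striction S) \<and>
    smooth_curve_on (params S) (director S) \<and>
    (\<forall>s\<in>params S.
      director S s \<bullet> director S s = 1 \<and>
      vderiv (director S) s \<bullet> vderiv (director S) s = 1 \<and>
      vderiv (striction S) s \<bullet> vderiv (director S) s = 0)"

definition t_vec :: "ruled_data \<Rightarrow> real \<Rightarrow> real ^ 3" where
  "t_vec S s = vderiv (director S) s"

definition g_vec :: "ruled_data \<Rightarrow> real \<Rightarrow> real ^ 3" where
  "g_vec S s = cross3 (director S s) (t_vec S s)"

definition conical_curvature :: "ruled_data \<Rightarrow> real \<Rightarrow> real" where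
  "conical_curvature S s =
    (THE k. vderiv (t_vec S) s = k *\<^sub>R g_vec S s - director S s \<and>
            vderiv (g_vec S) s = - k *\<^sub>R t_vec S s)"

definition Delta :: "ruled_data \<Rightarrow> real \<Rightarrow> real" where
  "Delta S s =
    det (vector [vderiv (striction S) s, director S s, t_vec S s] :: real ^ 3 ^ 3)"

definition delta :: "ruled_data \<Rightarrow> real \<Rightarrow> real" where
  "delta S s = vderiv (striction S) s \<bullet> director S s"

definition dual_e :: "ruled_data \<Rightarrow> real \<Rightarrow> (real ^ 3) dual" where
  "dual_e S s = Dual (director S s) (cross3 (striction S s) (director S s))"

definition dual_t :: "ruled_data \<Rightarrow> real \<Rightarrow> (real ^ 3) dual" where
  "dual_t S s = Dual (t_vec S s) (cross3 (striction S s) (t_vec S s))"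

definition dual_g :: "ruled_data \<Rightarrow> real \<Rightarrow> (real ^ 3) dual" where
  "dual_g S s = Dual (g_vec S s) (cross3 (striction S s) (g_vec S s))"

definition dual_conical_curvature :: "ruled_data \<Rightarrow> real \<Rightarrow> real dual" where
  "dual_conical_curvature S s =
    Dual (conical_curvature S s) (delta S s - conical_curvature S s * Delta S s)"

definition unit_dual_Darboux :: "ruled_data \<Rightarrow> real \<Rightarrow> (real ^ 3) dual" where
  "unit_dual_Darboux S s =
    dual_scale (dual_inverse (dual_sqrt (1 + (dual_conical_curvature S s)\<^sup>2)))
      (dual_scale (dual_conical_curvature S s) (dual_e S s) + dual_g S s)"

definition dual_spherical_radius :: "ruled_data \<Rightarrow> real \<Rightarrow> real dual" where
  "dual_spherical_radius S s = dual_angle (dual_e S s) (unit_dual_Darboux S s)"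


section \<open>Bertrand offsets\<close>

text \<open>\<open>h\<close> is the correspondence \<open>s\<^sub>1 = h s\<close> between the rulings.\<close>

definition bertrand_offset :: "ruled_data \<Rightarrow> ruled_data \<Rightarrow> (real \<Rightarrow> real) \<Rightarrow> bool" where
  "bertrand_offset S S1 h \<longleftrightarrow>
    bij_betw h (params S) (params S1) \<and>
    (\<forall>s\<in>params S. h differentiable (at s) \<and> deriv h s \<noteq> 0) \<and>
    (\<forall>s\<in>params S. dual_t S1 (h s) = dual_t S s)"

text \<open>
  The dual angle between \<open>dual_e S s\<close> and \<open>dual_e S1 (h s)\<close>, in the sense of rotation that makes
  the frame relation below hold: the dual cosine alone would leave the sign of the second
  coefficient open. The relation for \<open>dual_g S1 (h s)\<close> follows from it and the Bertrand condition.
  Constancy of the angle along the surface is not assumed.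
\<close>

definition offset_dual_angle ::
  "ruled_data \<Rightarrow> ruled_data \<Rightarrow> (real \<Rightarrow> real) \<Rightarrow> (real \<Rightarrow> real dual) \<Rightarrow> bool" where
  "offset_dual_angle S S1 h \<phi> \<longleftrightarrow>
    (\<forall>s\<in>params S.
      is_dual_angle (\<phi> s) (dual_e S s) (dual_e S1 (h s)) \<and>
      dual_e S1 (h s) =
        dual_scale (dual_cos (\<phi> s)) (dual_e S s) - dual_scale (dual_sin (\<phi> s)) (dual_g S s))"

text \<open>\<open>ds/ds\<^sub>1\<close>, the derivative of the inverse correspondence, at \<open>s\<^sub>1 = h s\<close>.\<close>

definition ds_ds1 :: "ruled_data \<Rightarrow> (real \<Rightarrow> real) \<Rightarrow> real \<Rightarrow> real" where
  "ds_ds1 S h s = deriv (the_inv_into (params S) h) (h s)"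

end

theory Submission
  imports Defs
begin

text \<open>
  Write \<open>e\<close>, \<open>t\<close>, \<open>g\<close> for the dual Darboux frame. Along a ruled surface the dual
  Frenet equation \<open>t' = (\<gamma> + \<epsilon>\<delta>) g - (1 + \<epsilon>\<Delta>) e\<close> holds (\<open>dual_t_derivative\<close>), so the two dual
  numbers \<open>\<Gamma> = \<gamma> + \<epsilon>\<delta>\<close> and \<open>P = 1 + \<epsilon>\<Delta>\<close> carry all the invariants involved, and
  the dual conical curvature is their quotient \<open>\<Gamma> / P\<close>.

  For a Bertrand offset, \<open>t\<^sub>1\<close> at the parameter \<open>h s\<close> equals \<open>t\<close> at \<open>s\<close>.
  Differentiating this single identity gives
  \<open>h' (\<Gamma>\<^sub>1 g\<^sub>1 - P\<^sub>1 e\<^sub>1) = \<Gamma> g - P e\<close>, whereas the frames \<open>{e, g}\<close> and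
  \<open>{e\<^sub>1, g\<^sub>1}\<close> differ by the rotation through the dual offset angle. Taking dual inner
  products with \<open>e\<^sub>1\<close> and \<open>g\<^sub>1\<close> (\<open>bertrand_offset_invariants\<close>) yields
  \<open>h' P\<^sub>1 = cos \<theta> P + sin \<theta> \<Gamma>\<close> and \<open>h' \<Gamma>\<^sub>1 = cos \<theta> \<Gamma> - sin \<theta> P\<close> with the dual
  angle \<open>\<theta>\<close>. The angle itself is never differentiated; only its value at \<open>s\<close> enters.

  Separating real and dual parts shows that the dual conical curvature of the offset is
  \<open>A + \<epsilon> B / A\<close>. The claim is then \<open>cos \<rho> = k / sqrt (1 + k\<^sup>2)\<close> for dual \<open>k\<close>
  (\<open>dual_cos_spherical_radius\<close>): the inner product of \<open>e\<close> with the unit Darboux vector has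
  this value, its real part lies strictly between \<open>-1\<close> and \<open>1\<close>, and therefore the dual
  angle exists and is unique.
\<close>

section \<open>Dual vectors\<close>

lemma dual_number_simps [simp]:
  "primal 0 = 0" "tangent 0 = 0"
  "primal (x + y) = primal x + primal y" "tangent (x + y) = tangent x + tangent y"
  "primal (x - y) = primal x - primal y" "tangent (x - y) = tangent x - tangent y"
  "primal (- x) = - primal x" "tangent (- x) = - tangent x"
  by (simp_all add: zero_dual_def plus_dual_def minus_dual_def uminus_dual_def)

lemma dual_ring_simps [simp]:
  "primal 1 = 1" "tangent 1 = 0"
  "primal (a * b) = primal a * primal b"
  "tangent (a * b) = primal a * tangent b + tangent a * primal b"
  by (simp_all add: one_dual_def times_dual_def)

lemma dual_vector_simps [simp]:
  "primal (dual_scale a x) = primal a *\<^sub>R primal x"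
  "tangent (dual_scale a x) = primal a *\<^sub>R tangent x + tangent a *\<^sub>R primal x"
  "primal (dual_inner x y) = primal x \<bullet> primal y"
  "tangent (dual_inner x y) = primal x \<bullet> tangent y + tangent x \<bullet> primal y"
  by (simp_all add: dual_scale_def dual_inner_def)

lemma dual_cos_Dual: "dual_cos (Dual a b) = Dual (cos a) (- b * sin a)"
proof -
  have "deriv cos a = - sin a"
    by (rule DERIV_imp_deriv) (auto intro!: derivative_eq_intros)
  then show ?thesis by (simp add: dual_lift_def)
qed

lemma dual_sin_Dual: "dual_sin (Dual a b) = Dual (sin a) (b * cos a)"
proof -
  have "deriv sin a = cos a"
    by (rule DERIV_imp_deriv) (auto intro!: derivative_eq_intros)
  then show ?thesis by (simp add: dual_lift_def)
qed

lemma dual_inner_linear: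
  "dual_inner (dual_scale a x) z = a * dual_inner x z"
  "dual_inner z (dual_scale a x) = a * dual_inner z x"
  "dual_inner (x + y) z = dual_inner x z + dual_inner y z"
  "dual_inner z (x + y) = dual_inner z x + dual_inner z y"
  "dual_inner (x - y) z = dual_inner x z - dual_inner y z"
  "dual_inner z (x - y) = dual_inner z x - dual_inner z y"
  by (simp_all add: dual.expand algebra_simps)

text \<open>
  The \<open>\<epsilon>\<close>-bilinear vector product recovers \<open>dual_g S1\<close> from \<open>dual_e S1\<close> and
  \<open>dual_t S1\<close>, so the offset relation between \<open>dual_e S\<close> and \<open>dual_e S1\<close> implies the one
  between \<open>dual_g S\<close> and \<open>dual_g S1\<close>.
\<close>

definition dual_cross :: "(real ^ 3) dual \<Rightarrow> (real ^ 3) dual \<Rightarrow> (real ^ 3) dual" where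
  "dual_cross x y = Dual (cross3 (primal x) (primal y))
    (cross3 (primal x) (tangent y) + cross3 (tangent x) (primal y))"

lemma dual_cross_linear:
  "dual_cross (dual_scale a x) z = dual_scale a (dual_cross x z)"
  "dual_cross (x - y) z = dual_cross x z - dual_cross y z"
  by (simp_all add: dual.expand dual_cross_def cross_mult_left cross_mult_right
      cross_add_left Cross3.left_diff_distrib algebra_simps)

text \<open>
  Pluecker coordinates of the line through \<open>c\<close> with direction \<open>v\<close>. For fixed \<open>c\<close> it
  translates the line through the origin to \<open>c\<close>. Translations preserve dual inner and vector
  products, which is why a dual frame inherits all its algebraic relations from the real one.
\<close>

definition line_vector :: "real ^ 3 \<Rightarrow> real ^ 3 \<Rightarrow> (real ^ 3) dual" where
  "line_vector c v = Dual v (cross3 c v)"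

lemma dual_inner_line_vector:
  "dual_inner (line_vector c v) (line_vector c w) = Dual (v \<bullet> w) 0"
proof -
  have "v \<bullet> cross3 c w = - (cross3 c v \<bullet> w)"
    by (metis cross_skew cross_triple inner_commute inner_minus_left)
  then show ?thesis by (simp add: dual.expand line_vector_def)
qed

text \<open>The dual part is the Jacobi identity: \<open>v \<mapsto> c \<times> v\<close> is a derivation.\<close>

lemma dual_cross_line_vector:
  "dual_cross (line_vector c v) (line_vector c w) = line_vector c (cross3 v w)"
  by (simp add: dual.expand line_vector_def dual_cross_def)
     (simp add: cross3_def vec_eq_iff forall_3 algebra_simps)

text \<open>
  Away from the values \<open>1\<close> and \<open>-1\<close> of the real cosine the real sine is nonzero, so the dual part of
  \<open>cos \<phi>\<close> determines the dual part of \<open>\<phi>\<close>; then the definite description in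
  \<open>dual_angle\<close> denotes an actual dual angle.
\<close>

lemma dual_cos_dual_angle:
  assumes "\<bar>primal (dual_inner x y)\<bar> < 1"
  shows "dual_cos (dual_angle x y) = dual_inner x y"
proof -
  let ?p = "primal (dual_inner x y)" and ?q = "tangent (dual_inner x y)"
  have p: "- 1 < ?p" "?p < 1" using assms by linarith+
  have sin0: "sin (arccos ?p) \<noteq> 0"
    using sin_arccos_nonzero p by simp
  have iff: "is_dual_angle \<phi> x y \<longleftrightarrow> \<phi> = Dual (arccos ?p) (- ?q / sin (arccos ?p))" for \<phi>
  proof
    assume a: "is_dual_angle \<phi> x y"
    obtain a b where [simp]: "\<phi> = Dual a b" by (cases \<phi>)
    have "0 \<le> a" "a \<le> pi" and eq: "dual_inner x y = Dual (cos a) (- b * sin a)"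
      using a by (simp_all add: is_dual_angle_def dual_cos_Dual)
    then have arc: "arccos ?p = a" by (simp add: arccos_cos)
    have "?q = - b * sin (arccos ?p)" unfolding arc using eq by (metis dual.sel(2))
    then have "b = - ?q / sin (arccos ?p)"
      using sin0 by (simp only: divide_simps) simp
    with arc show "\<phi> = Dual (arccos ?p) (- ?q / sin (arccos ?p))" by simp
  next
    assume [simp]: "\<phi> = Dual (arccos ?p) (- ?q / sin (arccos ?p))"
    have "dual_cos \<phi> = Dual ?p ?q" using p sin0 by (simp add: dual_cos_Dual del: dual_vector_simps)
    also have "\<dots> = dual_inner x y" by (rule dual.collapse)
    finally show "is_dual_angle \<phi> x y"
      using p by (simp add: is_dual_angle_def arccos_lbound arccos_ubound del: dual_vector_simps)
  qed
  then have "is_dual_angle (dual_angle x y) x y"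
    unfolding dual_angle_def by (simp only: iff the_eq_trivial)
  then show ?thesis by (simp add: is_dual_angle_def)
qed

section \<open>The Frenet equations\<close>

lemma bounded_bilinear_cross3: "bounded_bilinear cross3"
  using bilinear_cross by (simp add: bilinear_conv_bounded_bilinear)

text \<open>
  \<open>t_vec\<close> is the first derivative of the director only inside the parameter interval; openness
  of the interval makes this enough to differentiate it again.
\<close>

lemma director_derivatives:
  assumes S: "ruled_surface S" and s: "s \<in> params S"
  obtains t' where "(director S has_vector_derivative t_vec S s) (at s)"
    and "(t_vec S has_vector_derivative t') (at s)"
proof -
  obtain D where D0: "D 0 = director S" and
    D: "\<And>n u. u \<in> params S \<Longrightarrow> (D n has_vector_derivative D (Suc n) u) (at u)"
    using S unfolding ruled_surface_def smooth_curve_on_def by blast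
  have t: "D 1 u = t_vec S u" if "u \<in> params S" for u
    using vector_derivative_at[OF D[OF that, of 0]] by (simp add: D0 t_vec_def)
  have "open (params S)" using S by (simp add: ruled_surface_def)
  then have "(t_vec S has_vector_derivative D 2 s) (at s)"
    using D[OF s, of 1] t s
    by (auto intro: has_vector_derivative_transform_within_open simp: numeral_2_eq_2)
  moreover have "(director S has_vector_derivative t_vec S s) (at s)"
    using D[OF s, of 0] t[OF s] by (simp add: D0)
  ultimately show thesis using that by blast
qed

lemma striction_derivative:
  assumes "ruled_surface S" "s \<in> params S"
  shows "(striction S has_vector_derivative vderiv (striction S) s) (at s)"
  using assms unfolding ruled_surface_def smooth_curve_on_def
  by (metis vector_derivative_at)

lemma has_vector_derivative_inner_const:
  fixes f g :: "real \<Rightarrow> real ^ 3"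
  assumes "open I" "s \<in> I" "\<And>u. u \<in> I \<Longrightarrow> f u \<bullet> g u = k"
    and f: "(f has_vector_derivative f') (at s)" and g: "(g has_vector_derivative g') (at s)"
  shows "f s \<bullet> g' + f' \<bullet> g s = 0"
proof -
  have "((\<lambda>u. f u \<bullet> g u) has_vector_derivative f s \<bullet> g' + f' \<bullet> g s) (at s)"
    by (rule bounded_bilinear.has_vector_derivative[OF bounded_bilinear_inner f g])
  moreover have "((\<lambda>u. f u \<bullet> g u) has_vector_derivative 0) (at s)"
    by (rule has_vector_derivative_transform_within_open[OF has_vector_derivative_const assms(1,2)])
       (simp add: assms(3))
  ultimately show ?thesis using vector_derivative_unique_at by blast
qed

lemma director_orthonormal:
  assumes S: "ruled_surface S" and s: "s \<in> params S"
  shows "director S s \<bullet> director S s = 1" "t_vec S s \<bullet> t_vec S s = 1"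
    "director S s \<bullet> t_vec S s = 0"
proof -
  have unit: "director S u \<bullet> director S u = 1" "t_vec S u \<bullet> t_vec S u = 1"
    if "u \<in> params S" for u
    using S that by (simp_all add: ruled_surface_def t_vec_def)
  show "director S s \<bullet> director S s = 1" "t_vec S s \<bullet> t_vec S s = 1"
    using unit s by blast+
  have "(director S has_vector_derivative t_vec S s) (at s)"
    using director_derivatives[OF S s] by blast
  from has_vector_derivative_inner_const[OF _ s unit(1) this this] S
  show "director S s \<bullet> t_vec S s = 0"
    by (simp add: ruled_surface_def inner_commute)
qed

lemma cross3_orthonormal:
  fixes e t :: "real ^ 3"
  assumes "e \<bullet> e = 1" "t \<bullet> t = 1" "e \<bullet> t = 0"
  shows "cross3 e t \<bullet> cross3 e t = 1"
    and "cross3 e (cross3 e t) = - t" and "cross3 (cross3 e t) t = - e"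
  using assms by (simp_all add: dot_cross Lagrange cross_skew[of "cross3 e t" t] inner_commute)

text \<open>Both sides have the same inner and vector product with \<open>e \<times> t\<close>, and these determine a vector.\<close>

lemma orthonormal_expansion:
  fixes e t v :: "real ^ 3"
  assumes "e \<bullet> e = 1" "t \<bullet> t = 1" "e \<bullet> t = 0"
  shows "v = (v \<bullet> e) *\<^sub>R e + (v \<bullet> t) *\<^sub>R t + (v \<bullet> cross3 e t) *\<^sub>R cross3 e t" (is "v = ?w")
proof (rule cross_dot_cancel[where x = "cross3 e t"])
  note g = cross3_orthonormal[OF assms]
  show "cross3 e t \<noteq> 0" using g(1) by auto
  show "cross3 e t \<bullet> v = cross3 e t \<bullet> ?w"
    using g(1) by (simp add: inner_add_right dot_cross_self inner_commute)
  have "cross3 (cross3 e t) e = t" using g(2) cross_skew[of "cross3 e t" e] by simp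
  then have "cross3 (cross3 e t) ?w = (v \<bullet> e) *\<^sub>R t - (v \<bullet> t) *\<^sub>R e"
    using g(3) by (simp add: cross_add_right cross_mult_right)
  also have "\<dots> = cross3 (cross3 e t) v"
    by (simp add: cross_skew[of "cross3 e t" v] Lagrange)
  finally show "cross3 (cross3 e t) v = cross3 (cross3 e t) ?w" by simp
qed

text \<open>
  Differentiating \<open>e \<bullet> t = 0\<close> and \<open>t \<bullet> t = 1\<close> determines the components of \<open>t'\<close> along
  \<open>e\<close> and \<open>t\<close>. The remaining component \<open>k = t' \<bullet> g\<close> also satisfies \<open>g' = - k t\<close>,
  so \<open>k\<close> is the unique solution that defines the conical curvature.
\<close>

lemma t_vec_derivative:
  assumes S: "ruled_surface S" and s: "s \<in> params S"
  shows "(t_vec S has_vector_derivative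
    conical_curvature S s *\<^sub>R g_vec S s - director S s) (at s)"
proof -
  obtain t' where e': "(director S has_vector_derivative t_vec S s) (at s)"
    and t': "(t_vec S has_vector_derivative t') (at s)"
    using director_derivatives[OF S s] by blast
  note on = director_orthonormal[OF S]
  have I: "open (params S)" using S by (simp add: ruled_surface_def)
  have "t_vec S s \<bullet> t' = 0"
    using has_vector_derivative_inner_const[OF I s on(2) t' t'] by (simp add: inner_commute)
  moreover have "director S s \<bullet> t' = - 1"
    using has_vector_derivative_inner_const[OF I s on(3) e' t'] on(2)[OF s] by simp
  ultimately have t'_eq: "t' = (t' \<bullet> g_vec S s) *\<^sub>R g_vec S s - director S s"
    using orthonormal_expansion[OF on[OF s], of t'] by (simp add: g_vec_def inner_commute)
  define k where "k = t' \<bullet> g_vec S s"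
  note g = cross3_orthonormal[OF on[OF s], folded g_vec_def]
  have "(g_vec S has_vector_derivative
      cross3 (director S s) t' + cross3 (t_vec S s) (t_vec S s)) (at s)"
    unfolding g_vec_def[abs_def]
    by (rule bounded_bilinear.has_vector_derivative[OF bounded_bilinear_cross3 e' t'])
  moreover have "cross3 (director S s) t' = - k *\<^sub>R t_vec S s"
    by (subst t'_eq) (simp add: k_def Cross3.right_diff_distrib cross_mult_right g)
  ultimately have g': "vderiv (g_vec S) s = - k *\<^sub>R t_vec S s"
    by (simp add: vector_derivative_at)
  have "conical_curvature S s = k"
    unfolding conical_curvature_def
  proof (rule the_equality)
    show "vderiv (t_vec S) s = k *\<^sub>R g_vec S s - director S s \<and>
      vderiv (g_vec S) s = - k *\<^sub>R t_vec S s"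
      using g' vector_derivative_at[OF t'] t'_eq by (simp add: k_def)
  next
    fix j
    assume "vderiv (t_vec S) s = j *\<^sub>R g_vec S s - director S s \<and>
      vderiv (g_vec S) s = - j *\<^sub>R t_vec S s"
    with g' have "- j *\<^sub>R t_vec S s = - k *\<^sub>R t_vec S s" by simp
    moreover have "t_vec S s \<noteq> 0" using on(2)[OF s] by auto
    ultimately show "j = k" by simp
  qed
  with t' t'_eq show ?thesis by (simp add: k_def)
qed

definition has_dual_derivative ::
  "(real \<Rightarrow> (real ^ 3) dual) \<Rightarrow> (real ^ 3) dual \<Rightarrow> real \<Rightarrow> bool" where
  "has_dual_derivative F F' s \<longleftrightarrow>
    ((\<lambda>u. primal (F u)) has_vector_derivative primal F') (at s) \<and>
    ((\<lambda>u. tangent (F u)) has_vector_derivative tangent F') (at s)"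

lemma has_dual_derivative_unique:
  "has_dual_derivative F X s \<Longrightarrow> has_dual_derivative F Y s \<Longrightarrow> X = Y"
  unfolding has_dual_derivative_def by (metis dual.expand vector_derivative_unique_at)

lemma has_dual_derivative_transform:
  assumes "has_dual_derivative F X s" "open I" "s \<in> I" "\<And>u. u \<in> I \<Longrightarrow> F u = G u"
  shows "has_dual_derivative G X s"
  using assms unfolding has_dual_derivative_def
  by (auto intro: has_vector_derivative_transform_within_open)

lemma has_dual_derivative_chain:
  assumes h: "(h has_real_derivative k) (at s)" and F: "has_dual_derivative F X (h s)"
  shows "has_dual_derivative (\<lambda>u. F (h u)) (dual_scale (Dual k 0) X) s"
  using vector_diff_chain_at[OF h[unfolded has_real_derivative_iff_has_vector_derivative],
      of "\<lambda>u. primal (F u)"]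
    vector_diff_chain_at[OF h[unfolded has_real_derivative_iff_has_vector_derivative],
      of "\<lambda>u. tangent (F u)"] F
  by (simp add: has_dual_derivative_def o_def)

lemma frame_line_vectors:
  "dual_e S s = line_vector (striction S s) (director S s)"
  "dual_t S s = line_vector (striction S s) (t_vec S s)"
  "dual_g S s = line_vector (striction S s) (g_vec S s)"
  by (simp_all add: dual_e_def dual_t_def dual_g_def line_vector_def)

lemma dual_frame:
  assumes S: "ruled_surface S" and s: "s \<in> params S"
  shows "dual_inner (dual_e S s) (dual_e S s) = 1"
    "dual_inner (dual_g S s) (dual_g S s) = 1"
    "dual_inner (dual_e S s) (dual_g S s) = 0"
    "dual_inner (dual_g S s) (dual_e S s) = 0"
    "dual_cross (dual_e S s) (dual_t S s) = dual_g S s"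
    "dual_cross (dual_g S s) (dual_t S s) = - dual_e S s"
  using director_orthonormal[OF S s] cross3_orthonormal[OF director_orthonormal[OF S s]]
  unfolding frame_line_vectors dual_inner_line_vector dual_cross_line_vector
  by (simp_all add: g_vec_def dot_cross_self one_dual_def zero_dual_def)
     (simp add: line_vector_def uminus_dual_def)

lemma striction_tangent:
  assumes S: "ruled_surface S" and s: "s \<in> params S"
  shows "vderiv (striction S) s = delta S s *\<^sub>R director S s + Delta S s *\<^sub>R g_vec S s"
proof -
  have "vderiv (striction S) s \<bullet> t_vec S s = 0"
    using S s by (simp add: ruled_surface_def t_vec_def)
  with orthonormal_expansion[OF director_orthonormal[OF S s], of "vderiv (striction S) s"]
  show ?thesis by (simp add: delta_def Delta_def g_vec_def dot_cross_det)
qed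

text \<open>
  Here \<open>e\<close>, \<open>t\<close>, \<open>g\<close> are the real frame and \<open>c\<close> is the striction line. The dual part of
  the derivative of \<open>dual_t\<close> is \<open>c' \<times> t + c \<times> t'\<close>. Its second term is the moment of the real
  Frenet equation; by \<open>c' = \<delta> e + \<Delta> g\<close> its first term is \<open>\<delta> g - \<Delta> e\<close>, which
  supplies the dual parts of the coefficients.
\<close>

lemma dual_t_derivative:
  assumes S: "ruled_surface S" and s: "s \<in> params S"
  shows "has_dual_derivative (dual_t S)
    (dual_scale (Dual (conical_curvature S s) (delta S s)) (dual_g S s)
      - dual_scale (Dual 1 (Delta S s)) (dual_e S s)) s"
proof -
  note g = cross3_orthonormal[OF director_orthonormal[OF S s], folded g_vec_def]
  note t' = t_vec_derivative[OF S s]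
  have "cross3 (vderiv (striction S) s) (t_vec S s)
      = delta S s *\<^sub>R g_vec S s - Delta S s *\<^sub>R director S s"
    by (simp add: striction_tangent[OF S s] cross_add_left cross_mult_left g g_vec_def[symmetric])
  with bounded_bilinear.has_vector_derivative
    [OF bounded_bilinear_cross3 striction_derivative[OF S s] t'] t'
  show ?thesis
    by (simp add: has_dual_derivative_def dual_t_def dual_g_def dual_e_def
        Cross3.right_diff_distrib cross_mult_right algebra_simps)
qed

section \<open>Bertrand offsets\<close>

text \<open>
  The correspondence is only assumed to be differentiable, with no continuity of \<open>h'\<close>; the inverse
  is continuous because a continuous injection of an open interval is open.
\<close>

lemma offset_derivative:
  assumes S: "ruled_surface S" and off: "bertrand_offset S S1 h" and s: "s \<in> params S"
  shows "(h has_real_derivative deriv h s) (at s)" "deriv h s \<noteq> 0"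
    "ds_ds1 S h s = inverse (deriv h s)"
proof -
  have diff: "(h has_real_derivative deriv h u) (at u)" if "u \<in> params S" for u
    using off that unfolding bertrand_offset_def
    by (metis DERIV_imp_deriv real_differentiable_def)
  show 1: "(h has_real_derivative deriv h s) (at s)" by (rule diff[OF s])
  show 2: "deriv h s \<noteq> 0" using off s by (simp add: bertrand_offset_def)
  have cont: "continuous_on (params S) h"
    using diff by (meson DERIV_isCont continuous_at_imp_continuous_on)
  have "(the_inv_into (params S) h has_derivative (*) (inverse (deriv h s))) (at (h s))"
  proof (rule has_derivative_inverse_strong[OF _ s cont])
    show "(h has_derivative (*) (deriv h s)) (at s)"
      using 1 by (simp add: has_field_derivative_def)
    show "(*) (deriv h s) \<circ> (*) (inverse (deriv h s)) = id" using 2 by auto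
    show "open (params S)" using S by (simp add: ruled_surface_def)
    show "the_inv_into (params S) h (h u) = u" if "u \<in> params S" for u
      using off that by (simp add: bertrand_offset_def bij_betw_def the_inv_into_f_f)
  qed
  then show "ds_ds1 S h s = inverse (deriv h s)"
    unfolding ds_ds1_def by (intro DERIV_imp_deriv) (simp add: has_field_derivative_def)
qed

text \<open>
  Here \<open>C\<close> and \<open>N\<close> stand for the dual cosine and sine of the offset angle at the parameter
  \<open>s\<close>. The relation between the rulings enters at this one parameter, since only the identity
  between \<open>dual_t S1\<close> and \<open>dual_t S\<close> is differentiated.
\<close>

lemma bertrand_offset_invariants:
  assumes S: "ruled_surface S" and S1: "ruled_surface S1" and off: "bertrand_offset S S1 h"
    and s: "s \<in> params S"
    and e1: "dual_e S1 (h s) = dual_scale C (dual_e S s) - dual_scale N (dual_g S s)"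
  shows "Dual (deriv h s) 0 * Dual 1 (Delta S1 (h s))
      = C * Dual 1 (Delta S s) + N * Dual (conical_curvature S s) (delta S s)"
    and "Dual (deriv h s) 0 * Dual (conical_curvature S1 (h s)) (delta S1 (h s))
      = C * Dual (conical_curvature S s) (delta S s) - N * Dual 1 (Delta S s)"
proof -
  have h_in: "h u \<in> params S1" and tt: "dual_t S1 (h u) = dual_t S u" if "u \<in> params S" for u
    using off that by (auto simp: bertrand_offset_def bij_betw_def)
  note fr = dual_frame[OF S s] and fr1 = dual_frame[OF S1 h_in[OF s]]
  let ?G = "Dual (conical_curvature S s) (delta S s)" and ?P = "Dual 1 (Delta S s)"
  let ?G1 = "Dual (conical_curvature S1 (h s)) (delta S1 (h s))"
    and ?P1 = "Dual 1 (Delta S1 (h s))" and ?H = "Dual (deriv h s) 0"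
  \<comment> \<open>The dual vector product of \<open>dual_e S1\<close> with the common \<open>dual_t\<close>.\<close>
  have g1: "dual_g S1 (h s) = dual_scale C (dual_g S s) + dual_scale N (dual_e S s)"
    unfolding fr1(5)[symmetric] e1 tt[OF s] dual_cross_linear fr(5,6)
    by (simp add: dual.expand)
  have "open (params S)" using S by (simp add: ruled_surface_def)
  then have "has_dual_derivative (dual_t S)
      (dual_scale ?H (dual_scale ?G1 (dual_g S1 (h s)) - dual_scale ?P1 (dual_e S1 (h s)))) s"
    using has_dual_derivative_transform[OF has_dual_derivative_chain
        [OF offset_derivative(1)[OF S off s] dual_t_derivative[OF S1 h_in[OF s]]] _ s tt]
    by blast
  then have key: "dual_scale ?H (dual_scale ?G1 (dual_g S1 (h s)) - dual_scale ?P1 (dual_e S1 (h s)))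
      = dual_scale ?G (dual_g S s) - dual_scale ?P (dual_e S s)" (is "?L = ?R")
    using has_dual_derivative_unique dual_t_derivative[OF S s] by blast
  have "dual_inner ?L (dual_e S1 (h s)) = - (?H * ?P1)"
    by (simp add: dual_inner_linear fr1)
  moreover have "dual_inner ?R (dual_e S1 (h s)) = - (C * ?P + N * ?G)"
    unfolding e1 by (simp add: dual_inner_linear fr algebra_simps)
  ultimately show "?H * ?P1 = C * ?P + N * ?G" unfolding key by (metis neg_equal_iff_equal)
  have "dual_inner ?L (dual_g S1 (h s)) = ?H * ?G1"
    by (simp add: dual_inner_linear fr1)
  moreover have "dual_inner ?R (dual_g S1 (h s)) = C * ?G - N * ?P"
    unfolding g1 by (simp add: dual_inner_linear fr algebra_simps)
  ultimately show "?H * ?G1 = C * ?G - N * ?P" unfolding key by metis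
qed

section \<open>The dual spherical radius of curvature\<close>

text \<open>
  The derivative of \<open>x / sqrt (1 + x\<^sup>2)\<close> is \<open>(1 + x\<^sup>2) powr (- 3 / 2)\<close>; the dual quotient
  reproduces it as the coefficient of \<open>b\<close>.
\<close>

lemma dual_normalize:
  fixes a b :: real
  shows "dual_inverse (dual_sqrt (1 + (Dual a b)\<^sup>2)) * Dual a b
    = Dual (a * (1 + a\<^sup>2) powr (- 1 / 2)) (b * (1 + a\<^sup>2) powr (- 3 / 2))"
proof -
  let ?r = "1 + a\<^sup>2"
  have r: "?r > 0" by (simp add: add_pos_nonneg)
  have d1: "deriv sqrt ?r = inverse (sqrt ?r) / 2"
    using r by (intro DERIV_imp_deriv DERIV_real_sqrt)
  have d2: "deriv inverse (sqrt ?r) = - inverse ((sqrt ?r)\<^sup>2)"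
  proof (rule DERIV_imp_deriv)
    have "sqrt ?r \<noteq> 0" using r by simp
    from DERIV_inverse[OF this]
    show "(inverse has_real_derivative - inverse ((sqrt ?r)\<^sup>2)) (at (sqrt ?r))"
      unfolding numeral_2_eq_2 power_inverse .
  qed
  have p1: "?r powr (- 1 / 2) = inverse (sqrt ?r)"
    using r by (simp add: powr_minus powr_half_sqrt[symmetric])
  have p3: "?r powr (- 3 / 2) = inverse (sqrt ?r * ?r)"
  proof -
    have "?r powr (- 3 / 2) = ?r powr (- 1 / 2) * ?r powr (- 1)"
      by (subst powr_add[symmetric]) simp
    also have "?r powr (- 1) = inverse ?r" using r by (simp add: powr_minus)
    finally show ?thesis using p1 by simp
  qed
  have sq: "(sqrt ?r)\<^sup>2 = ?r" using r by simp
  have pr: "1 + (Dual a b)\<^sup>2 = Dual ?r (2 * a * b)"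
    by (simp add: dual.expand power2_eq_square)
  have nz: "?r \<noteq> 0" using r by simp
  have "inverse (sqrt ?r) * b + (2 * a * b * (inverse (sqrt ?r) / 2)) * (- inverse ?r) * a
      = b * inverse (sqrt ?r * ?r)"
    using nz by (simp add: divide_simps) (simp add: power2_eq_square algebra_simps)
  then show ?thesis
    unfolding pr dual_lift_def dual.sel d1 d2 p1 p3 sq
    by (simp only: times_dual_def dual.sel mult.commute[of _ a])
qed

text \<open>
  Since \<open>e\<close> is a unit dual vector orthogonal to \<open>g\<close>, its inner product with the Darboux vector
  is the normalized conical curvature. Its real part \<open>a / sqrt (1 + a\<^sup>2)\<close> is less than \<open>1\<close> in
  absolute value, so the dual spherical radius is well defined and has this inner product as cosine.
\<close>

lemma dual_cos_spherical_radius: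
  assumes S: "ruled_surface S" and s: "s \<in> params S"
    and G: "dual_conical_curvature S s = Dual a b"
  shows "dual_cos (dual_spherical_radius S s)
    = Dual (a * (1 + a\<^sup>2) powr (- 1 / 2)) (b * (1 + a\<^sup>2) powr (- 3 / 2))"
proof -
  note fr = dual_frame[OF S s]
  have eq: "dual_inner (dual_e S s) (unit_dual_Darboux S s)
      = Dual (a * (1 + a\<^sup>2) powr (- 1 / 2)) (b * (1 + a\<^sup>2) powr (- 3 / 2))"
    unfolding unit_dual_Darboux_def G dual_inner_linear fr
    using dual_normalize[of a b] by simp
  have r: "1 + a\<^sup>2 > 0" by (simp add: add_pos_nonneg)
  have "\<bar>a\<bar> < sqrt (1 + a\<^sup>2)" by (simp add: real_less_rsqrt)
  then have "\<bar>a * (1 + a\<^sup>2) powr (- 1 / 2)\<bar> < 1"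
    using r by (simp add: powr_minus powr_half_sqrt abs_mult divide_simps)
  with eq have "\<bar>primal (dual_inner (dual_e S s) (unit_dual_Darboux S s))\<bar> < 1"
    by (metis dual.sel(1))
  then show ?thesis
    unfolding dual_spherical_radius_def eq[symmetric] by (rule dual_cos_dual_angle)
qed

theorem theorem4p9:
  fixes S S1 :: ruled_data
    and h \<theta> \<theta>\<^sub>d :: "real \<Rightarrow> real"
    and s A B :: real
  assumes "ruled_surface S" and "ruled_surface S1"
    and "bertrand_offset S S1 h"
    and "offset_dual_angle S S1 h (\<lambda>u. Dual (\<theta> u) (\<theta>\<^sub>d u))"
    and "s \<in> params S"
    and "A = ds_ds1 S h s * (conical_curvature S s * cos (\<theta> s) - sin (\<theta> s))"
    and "B = A * ds_ds1 S h s *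
      (- (sin (\<theta> s) + A * cos (\<theta> s)) * Delta S s
       + (cos (\<theta> s) - A * sin (\<theta> s)) * delta S s
       - (A * (conical_curvature S s * cos (\<theta> s) - sin (\<theta> s))
          + cos (\<theta> s) + conical_curvature S s * sin (\<theta> s)) * \<theta>\<^sub>d s)"
    and "A \<noteq> 0"
  shows "dual_cos (dual_spherical_radius S1 (h s)) =
    Dual (A * (1 + A\<^sup>2) powr (- 1 / 2)) (B * inverse A * (1 + A\<^sup>2) powr (- 3 / 2))"
proof -
  note S = assms(1) and S1 = assms(2) and off = assms(3) and s = assms(5)
  have hs: "h s \<in> params S1" using off s by (auto simp: bertrand_offset_def bij_betw_def)
  let ?k = "deriv h s" and ?c = "cos (\<theta> s)" and ?n = "sin (\<theta> s)"
  let ?\<gamma> = "conical_curvature S s" and ?\<gamma>1 = "conical_curvature S1 (h s)"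
  let ?\<delta> = "delta S s" and ?\<Delta> = "Delta S s"
  let ?\<delta>1 = "delta S1 (h s)" and ?\<Delta>1 = "Delta S1 (h s)"
  have k: "?k \<noteq> 0" and x: "ds_ds1 S h s = inverse ?k"
    using offset_derivative[OF S off s] by simp_all
  have e1: "dual_e S1 (h s) = dual_scale (Dual ?c (- \<theta>\<^sub>d s * ?n)) (dual_e S s)
      - dual_scale (Dual ?n (\<theta>\<^sub>d s * ?c)) (dual_g S s)"
    using assms(4) s by (simp add: offset_dual_angle_def dual_cos_Dual dual_sin_Dual)
  note inv = bertrand_offset_invariants[OF S S1 off s e1]
  have \<Delta>1: "?k * ?\<Delta>1 = ?c * ?\<Delta> - \<theta>\<^sub>d s * ?n + ?n * ?\<delta> + \<theta>\<^sub>d s * ?c * ?\<gamma>"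
    using arg_cong[OF inv(1), of tangent] by simp
  have \<gamma>1: "?k * ?\<gamma>1 = ?c * ?\<gamma> - ?n"
    and \<delta>1: "?k * ?\<delta>1 = ?c * ?\<delta> - \<theta>\<^sub>d s * ?n * ?\<gamma> - ?n * ?\<Delta> - \<theta>\<^sub>d s * ?c"
    using arg_cong[OF inv(2), of primal] arg_cong[OF inv(2), of tangent] by simp_all
  have A: "?\<gamma>1 = A"
    using \<gamma>1 k by (simp add: assms(6) x field_simps)
  \<comment> \<open>\<open>B / A\<close> is the dual part \<open>\<delta>\<^sub>1 - \<gamma>\<^sub>1 \<Delta>\<^sub>1\<close> of the conical curvature of the offset.\<close>
  have "B = A * (inverse ?k * (?k * ?\<delta>1 - A * (?k * ?\<Delta>1)))"
    unfolding \<Delta>1 \<delta>1 assms(7) x by (simp add: algebra_simps)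
  then have "B * inverse A = inverse ?k * (?k * ?\<delta>1 - A * (?k * ?\<Delta>1))"
    using assms(8) by simp
  also have "\<dots> = ?\<delta>1 - A * ?\<Delta>1" using k by (simp add: field_simps)
  finally have "dual_conical_curvature S1 (h s) = Dual A (B * inverse A)"
    by (simp add: dual_conical_curvature_def A)
  then show ?thesis by (rule dual_cos_spherical_radius[OF S1 hs])
qed

end
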